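(* Let $(L,A,[\,\cdot\,,\ldots,\cdot\,],\rho)$ be an $n$-Lie--Rinehart algebra such that $L$ is a finitely generated projective $A$-module of rank $\ge 2$ at every point of $\operatorname{Spec}A$. Let $B:L\times L\to A$ be a symmetric, strongly nondegenerate $A$-bilinear form (i.e. $B^\flat:L\to L^{*}=\operatorname{Hom}_A(L,A)$, $u\mapsto B(u,\cdot)$, is an isomorphism) such that $D_XB=0$ for every fundamental element $X=x_1\wedge\cdots\wedge x_{n-1}$, i.e. $$\rho(x_1,\ldots,x_{n-1})(B(u,v))=B([x_1,\ldots,x_{n-1},u],v)+B(u,[x_1,\ldots,x_{n-1},v])$$ for all $x_1,\ldots,x_{n-1},u,v\in L$. Then $\rho\equiv 0$.
   Context: $K$ is a field of characteristic zero, $A$ is a commutative associative $K$-algebra, $n\ge 2$ is an integer, and $\operatorname{Der}_K(A)$ is the $A$-module of $K$-linear derivations of $A$, with commutator bracket. An $n$-Lie algebra over $K$ is a $K$-vector space $L$ with an alternating $K$-multilinear bracket $[\,\cdot\,,\ldots,\cdot\,]:L^n\to L$ satisfying the Filippov identity $[x_1,\ldots,x_{n-1},[y_1,\ldots,y_n]]=\sum_{i=1}^n[y_1,\ldots,[x_1,\ldots,x_{n-1},y_i],\ldots,y_n]$. For $X=x_1\wedge\cdots\wedge x_{n-1}$ and $Y=y_1\wedge\cdots\wedge y_{n-1}$ (fundamental elements, with chosen representatives) put $[X,z]=[x_1,\ldots,x_{n-1},z]$ and $X\circ Y=\sum_{i=1}^{n-1}y_1\wedge\cdots\wedge[X,y_i]\wedge\cdots\wedge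 y_{n-1}$. An $n$-Lie--Rinehart algebra over $A$ is a quadruple $(L,A,[\,\cdot\,,\ldots,\cdot\,],\rho)$ such that: (i) $L$ is an $A$-module and an $n$-Lie algebra over $K$; (ii)--(iii) $\rho:\bigwedge_A^{n-1}L\to\operatorname{Der}_K(A)$ (the anchor), regarded as an alternating $A$-multilinear map $\rho(x_1,\ldots,x_{n-1})=\rho(x_1\wedge\cdots\wedge x_{n-1})$, satisfies $[\rho(X),\rho(Y)]=\rho(X\circ Y)$ for all fundamental elements $X,Y$; (iv) $[x_1,\ldots,x_{n-1},ay]=a[x_1,\ldots,x_{n-1},y]+\rho(x_1,\ldots,x_{n-1})(a)\,y$ for all $x_j,y\in L$, $a\in A$. For a symmetric $A$-bilinear form $B$ on $L$ and a fundamental element $X$, the orthogonality defect is $(D_XB)(u,v)=\rho(X)(B(u,v))-B([X,u],v)-B(u,[X,v])$ for $u,v\in L$. *)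

theory Defs
  imports "HOL-Algebra.Ideal" "HOL-Algebra.Module"
begin

section \<open>Modules over a commutative ring\<close>

text \<open>The record type of modules extends that of rings. For a module that carries no ring structure
  the fields \<open>mult\<close> and \<open>one\<close> are irrelevant; they are left \<open>undefined\<close> below.\<close>

definition char_zero_ring :: "('a, 'c) ring_scheme \<Rightarrow> bool" where
  "char_zero_ring R \<longleftrightarrow> (\<forall>m::nat. m > 0 \<longrightarrow> [m] \<cdot>\<^bsub>R\<^esub> \<one>\<^bsub>R\<^esub> \<noteq> \<zero>\<^bsub>R\<^esub>)"

definition mod_hom ::
  "('a, 'c) ring_scheme \<Rightarrow> ('a, 'x, 'd) module_scheme \<Rightarrow> ('a, 'y, 'e) module_scheme \<Rightarrow> ('x \<Rightarrow> 'y) set"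
  where "mod_hom R M N =
    {f \<in> carrier M \<rightarrow>\<^sub>E carrier N.
      (\<forall>x\<in>carrier M. \<forall>y\<in>carrier M. f (x \<oplus>\<^bsub>M\<^esub> y) = f x \<oplus>\<^bsub>N\<^esub> f y) \<and>
      (\<forall>r\<in>carrier R. \<forall>x\<in>carrier M. f (r \<odot>\<^bsub>M\<^esub> x) = r \<odot>\<^bsub>N\<^esub> f x)}"

definition mod_iso ::
  "('a, 'c) ring_scheme \<Rightarrow> ('a, 'x, 'd) module_scheme \<Rightarrow> ('a, 'y, 'e) module_scheme \<Rightarrow> ('x \<Rightarrow> 'y) set"
  where "mod_iso R M N = {f \<in> mod_hom R M N. bij_betw f (carrier M) (carrier N)}"

definition self_module :: "('a, 'c) ring_scheme \<Rightarrow> ('a, 'a) module" where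
  "self_module R =
    \<lparr>carrier = carrier R, monoid.mult = monoid.mult R, one = one R,
     ring.zero = ring.zero R, ring.add = ring.add R, smult = monoid.mult R\<rparr>"

definition dual_module :: "('a, 'c) ring_scheme \<Rightarrow> ('a, 'x, 'd) module_scheme \<Rightarrow> ('a, 'x \<Rightarrow> 'a) module"
  where "dual_module R M =
    \<lparr>carrier = mod_hom R M (self_module R), monoid.mult = undefined, one = undefined,
     ring.zero = (\<lambda>x\<in>carrier M. \<zero>\<^bsub>R\<^esub>),
     ring.add = (\<lambda>f g. \<lambda>x\<in>carrier M. f x \<oplus>\<^bsub>R\<^esub> g x),
     smult = (\<lambda>r f. \<lambda>x\<in>carrier M. r \<otimes>\<^bsub>R\<^esub> f x)\<rparr>"

text \<open>Restriction of scalars along the structure map \<open>k \<mapsto> k \<odot> 1\<close> of a \<open>K\<close>-algebra \<open>A\<close>.\<close>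

definition restrict_scalars :: "('k, 'a, 'c) module_scheme \<Rightarrow> ('a, 'x, 'd) module_scheme \<Rightarrow> ('k, 'x) module"
  where "restrict_scalars A M =
    \<lparr>carrier = carrier M, monoid.mult = monoid.mult M, one = one M,
     ring.zero = ring.zero M, ring.add = ring.add M,
     smult = (\<lambda>k x. (k \<odot>\<^bsub>A\<^esub> \<one>\<^bsub>A\<^esub>) \<odot>\<^bsub>M\<^esub> x)\<rparr>"

definition fin_gen_module :: "('a, 'c) ring_scheme \<Rightarrow> ('a, 'x, 'd) module_scheme \<Rightarrow> bool" where
  "fin_gen_module R M \<longleftrightarrow>
    (\<exists>X. finite X \<and> X \<subseteq> carrier M \<and>
      (\<forall>y\<in>carrier M. \<exists>c\<in>X \<rightarrow> carrier R. y = (\<Oplus>\<^bsub>M\<^esub>x\<in>X. c x \<odot>\<^bsub>M\<^esub> x)))"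

definition free_module :: "('a, 'c) ring_scheme \<Rightarrow> 'i set \<Rightarrow> ('a, 'i \<Rightarrow> 'a) module" where
  "free_module R I =
    \<lparr>carrier = {c \<in> I \<rightarrow>\<^sub>E carrier R. finite {i \<in> I. c i \<noteq> \<zero>\<^bsub>R\<^esub>}},
     monoid.mult = undefined, one = undefined,
     ring.zero = (\<lambda>i\<in>I. \<zero>\<^bsub>R\<^esub>),
     ring.add = (\<lambda>c d. \<lambda>i\<in>I. c i \<oplus>\<^bsub>R\<^esub> d i),
     smult = (\<lambda>r c. \<lambda>i\<in>I. r \<otimes>\<^bsub>R\<^esub> c i)\<rparr>"

text \<open>Projective: (isomorphic to) a direct summand of a free module. Restricting the index set of
  the free module to the type of elements of \<open>M\<close> loses nothing, since every module is a quotient of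
  the free module on its own carrier.\<close>

definition projective_module :: "('a, 'c) ring_scheme \<Rightarrow> ('a, 'x, 'd) module_scheme \<Rightarrow> bool" where
  "projective_module R M \<longleftrightarrow>
    (\<exists>(I :: 'x set) j p. j \<in> mod_hom R M (free_module R I) \<and> p \<in> mod_hom R (free_module R I) M \<and>
      (\<forall>x\<in>carrier M. p (j x) = x))"

definition free_of_rank :: "('a, 'c) ring_scheme \<Rightarrow> ('a, 'x, 'd) module_scheme \<Rightarrow> nat \<Rightarrow> bool" where
  "free_of_rank R M r \<longleftrightarrow>
    (\<exists>b \<in> {..<r} \<rightarrow> carrier M. \<forall>y\<in>carrier M.
      \<exists>!c. c \<in> {..<r} \<rightarrow>\<^sub>E carrier R \<and> y = (\<Oplus>\<^bsub>M\<^esub>i\<in>{..<r}. c i \<odot>\<^bsub>M\<^esub> b i))"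


section \<open>Localization and rank\<close>

definition frac_rel ::
  "('a, 'c) ring_scheme \<Rightarrow> 'a set \<Rightarrow> ('a, 'x, 'd) module_scheme \<Rightarrow> (('x \<times> 'a) \<times> ('x \<times> 'a)) set"
  where "frac_rel R S M =
    {((x, s), (y, t)). x \<in> carrier M \<and> y \<in> carrier M \<and> s \<in> S \<and> t \<in> S \<and>
      (\<exists>u\<in>S. u \<odot>\<^bsub>M\<^esub> (t \<odot>\<^bsub>M\<^esub> x) = u \<odot>\<^bsub>M\<^esub> (s \<odot>\<^bsub>M\<^esub> y))}"

definition frac ::
  "('a, 'c) ring_scheme \<Rightarrow> 'a set \<Rightarrow> ('a, 'x, 'd) module_scheme \<Rightarrow> 'x \<Rightarrow> 'a \<Rightarrow> ('x \<times> 'a) set"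
  where "frac R S M x s = frac_rel R S M `` {(x, s)}"

text \<open>The operations are well defined on classes when \<open>S\<close> is a multiplicative subset of \<open>R\<close>; the unions
  below are then unions of families of equal sets.\<close>

definition loc_ring :: "('a, 'c) ring_scheme \<Rightarrow> 'a set \<Rightarrow> ('a \<times> 'a) set ring" where
  "loc_ring R S = (let M = self_module R in
    \<lparr>carrier = (carrier R \<times> S) // frac_rel R S M,
     monoid.mult = (\<lambda>X Y. \<Union>(a, s)\<in>X. \<Union>(b, t)\<in>Y. frac R S M (a \<otimes>\<^bsub>R\<^esub> b) (s \<otimes>\<^bsub>R\<^esub> t)),
     one = frac R S M \<one>\<^bsub>R\<^esub> \<one>\<^bsub>R\<^esub>,
     ring.zero = frac R S M \<zero>\<^bsub>R\<^esub> \<one>\<^bsub>R\<^esub>,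
     ring.add = (\<lambda>X Y. \<Union>(a, s)\<in>X. \<Union>(b, t)\<in>Y. frac R S M (t \<otimes>\<^bsub>R\<^esub> a \<oplus>\<^bsub>R\<^esub> s \<otimes>\<^bsub>R\<^esub> b) (s \<otimes>\<^bsub>R\<^esub> t))\<rparr>)"

definition loc_module ::
  "('a, 'c) ring_scheme \<Rightarrow> 'a set \<Rightarrow> ('a, 'x, 'd) module_scheme \<Rightarrow> (('a \<times> 'a) set, ('x \<times> 'a) set) module"
  where "loc_module R S M =
    \<lparr>carrier = (carrier M \<times> S) // frac_rel R S M, monoid.mult = undefined, one = undefined,
     ring.zero = frac R S M \<zero>\<^bsub>M\<^esub> \<one>\<^bsub>R\<^esub>,
     ring.add = (\<lambda>X Y. \<Union>(x, s)\<in>X. \<Union>(y, t)\<in>Y. frac R S M (t \<odot>\<^bsub>M\<^esub> x \<oplus>\<^bsub>M\<^esub> s \<odot>\<^bsub>M\<^esub> y) (s \<otimes>\<^bsub>R\<^esub> t)),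
     smult = (\<lambda>X Y. \<Union>(a, s)\<in>X. \<Union>(y, t)\<in>Y. frac R S M (a \<odot>\<^bsub>M\<^esub> y) (s \<otimes>\<^bsub>R\<^esub> t))\<rparr>"

text \<open>\<open>M\<close> has rank \<open>r\<close> at the prime \<open>P\<close>: the \<open>R\<^sub>P\<close>-module \<open>M\<^sub>P\<close> is free of rank \<open>r\<close>.\<close>

definition has_rank_at ::
  "('a, 'c) ring_scheme \<Rightarrow> ('a, 'x, 'd) module_scheme \<Rightarrow> 'a set \<Rightarrow> nat \<Rightarrow> bool"
  where "has_rank_at R M P r \<longleftrightarrow>
    free_of_rank (loc_ring R (carrier R - P)) (loc_module R (carrier R - P) M) r"


section \<open>Multilinear maps and derivations\<close>

text \<open>The elements of \<open>M\<^sup>k\<close> are represented by lists.\<close>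

definition tuples :: "('x, 'c) partial_object_scheme \<Rightarrow> nat \<Rightarrow> 'x list set" where
  "tuples M k = {xs. length xs = k \<and> set xs \<subseteq> carrier M}"

definition alt_multilinear ::
  "('a, 'c) ring_scheme \<Rightarrow> ('a, 'x, 'd) module_scheme \<Rightarrow> nat \<Rightarrow> ('a, 'y, 'e) module_scheme \<Rightarrow>
    ('x list \<Rightarrow> 'y) \<Rightarrow> bool"
  where "alt_multilinear R M k N f \<longleftrightarrow>
    (\<forall>xs\<in>tuples M k. f xs \<in> carrier N) \<and>
    (\<forall>xs\<in>tuples M k. \<forall>i<k. \<forall>x\<in>carrier M. \<forall>y\<in>carrier M.
      f (xs[i := x \<oplus>\<^bsub>M\<^esub> y]) = f (xs[i := x]) \<oplus>\<^bsub>N\<^esub> f (xs[i := y])) \<and>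
    (\<forall>xs\<in>tuples M k. \<forall>i<k. \<forall>r\<in>carrier R. \<forall>x\<in>carrier M.
      f (xs[i := r \<odot>\<^bsub>M\<^esub> x]) = r \<odot>\<^bsub>N\<^esub> f (xs[i := x])) \<and>
    (\<forall>xs\<in>tuples M k. \<forall>i<k. \<forall>j<k. i \<noteq> j \<and> xs ! i = xs ! j \<longrightarrow> f xs = \<zero>\<^bsub>N\<^esub>)"

definition Der :: "('k, 'c) ring_scheme \<Rightarrow> ('k, 'a, 'd) module_scheme \<Rightarrow> ('a, 'a \<Rightarrow> 'a) module" where
  "Der K A =
    \<lparr>carrier = {D \<in> mod_hom K A A. \<forall>a\<in>carrier A. \<forall>b\<in>carrier A.
       D (a \<otimes>\<^bsub>A\<^esub> b) = a \<otimes>\<^bsub>A\<^esub> D b \<oplus>\<^bsub>A\<^esub> D a \<otimes>\<^bsub>A\<^esub> b},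
     monoid.mult = undefined, one = undefined,
     ring.zero = (\<lambda>a\<in>carrier A. \<zero>\<^bsub>A\<^esub>),
     ring.add = (\<lambda>D E. \<lambda>a\<in>carrier A. D a \<oplus>\<^bsub>A\<^esub> E a),
     smult = (\<lambda>b D. \<lambda>a\<in>carrier A. b \<otimes>\<^bsub>A\<^esub> D a)\<rparr>"

definition der_bracket :: "('k, 'a, 'd) module_scheme \<Rightarrow> ('a \<Rightarrow> 'a) \<Rightarrow> ('a \<Rightarrow> 'a) \<Rightarrow> 'a \<Rightarrow> 'a" where
  "der_bracket A D E = (\<lambda>a\<in>carrier A. D (E a) \<ominus>\<^bsub>A\<^esub> E (D a))"


section \<open>\<open>n\<close>-Lie--Rinehart algebras\<close>

text \<open>Positions in a tuple are counted from 0, so \<open>ys[i := z]\<close> replaces the entry \<open>y\<^sub>i\<^sub>+\<^sub>1\<close> by \<open>z\<close>.\<close>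

locale n_Lie_algebra =
  fixes K :: "('k, 'c) ring_scheme" and V :: "('k, 'x, 'd) module_scheme"
    and n :: nat and br :: "'x list \<Rightarrow> 'x"
  assumes field: "field K"
    and module: "module K V"
    and bracket: "alt_multilinear K V n V br"
    and Filippov: "\<And>xs ys. \<lbrakk>xs \<in> tuples V (n - 1); ys \<in> tuples V n\<rbrakk> \<Longrightarrow>
      br (xs @ [br ys]) = (\<Oplus>\<^bsub>V\<^esub>i\<in>{..<n}. br (ys[i := br (xs @ [ys ! i])]))"

text \<open>The anchor is given as an alternating \<open>A\<close>-multilinear map on \<open>(n - 1)\<close>-tuples. Hence
  \<open>\<rho> (X \<circ> Y)\<close> for \<open>X \<circ> Y = \<Sum>\<^sub>i y\<^sub>1 \<and> \<dots> \<and> [X, y\<^sub>i] \<and> \<dots> \<and> y\<^sub>n\<^sub>-\<^sub>1\<close> is the sum of the values of \<open>\<rho>\<close>.\<close>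

locale n_Lie_Rinehart_algebra =
  fixes K :: "('k, 'c) ring_scheme" and A :: "('k, 'a, 'd) module_scheme"
    and L :: "('a, 'x, 'e) module_scheme"
    and n :: nat and br :: "'x list \<Rightarrow> 'x" and \<rho> :: "'x list \<Rightarrow> 'a \<Rightarrow> 'a"
  assumes algebra: "algebra K A"
    and module: "module A L"
    and n_Lie: "n_Lie_algebra K (restrict_scalars A L) n br"
    and anchor: "alt_multilinear A L (n - 1) (Der K A) \<rho>"
    and anchor_bracket: "\<And>xs ys. \<lbrakk>xs \<in> tuples L (n - 1); ys \<in> tuples L (n - 1)\<rbrakk> \<Longrightarrow>
      der_bracket A (\<rho> xs) (\<rho> ys) =
        (\<Oplus>\<^bsub>Der K A\<^esub>i\<in>{..<n - 1}. \<rho> (ys[i := br (xs @ [ys ! i])]))"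
    and Leibniz: "\<And>xs a y. \<lbrakk>xs \<in> tuples L (n - 1); a \<in> carrier A; y \<in> carrier L\<rbrakk> \<Longrightarrow>
      br (xs @ [a \<odot>\<^bsub>L\<^esub> y]) = a \<odot>\<^bsub>L\<^esub> br (xs @ [y]) \<oplus>\<^bsub>L\<^esub> \<rho> xs a \<odot>\<^bsub>L\<^esub> y"


section \<open>Bilinear forms\<close>

definition sym_bilinear_form ::
  "('a, 'c) ring_scheme \<Rightarrow> ('a, 'x, 'd) module_scheme \<Rightarrow> ('x \<Rightarrow> 'x \<Rightarrow> 'a) \<Rightarrow> bool"
  where "sym_bilinear_form R M B \<longleftrightarrow>
    (\<forall>u\<in>carrier M. \<forall>v\<in>carrier M. B u v \<in> carrier R \<and> B u v = B v u) \<and>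
    (\<forall>u\<in>carrier M. \<forall>v\<in>carrier M. \<forall>w\<in>carrier M.
      B (u \<oplus>\<^bsub>M\<^esub> v) w = B u w \<oplus>\<^bsub>R\<^esub> B v w \<and> B w (u \<oplus>\<^bsub>M\<^esub> v) = B w u \<oplus>\<^bsub>R\<^esub> B w v) \<and>
    (\<forall>r\<in>carrier R. \<forall>u\<in>carrier M. \<forall>v\<in>carrier M.
      B (r \<odot>\<^bsub>M\<^esub> u) v = r \<otimes>\<^bsub>R\<^esub> B u v \<and> B u (r \<odot>\<^bsub>M\<^esub> v) = r \<otimes>\<^bsub>R\<^esub> B u v)"

definition flat :: "('a, 'x, 'd) module_scheme \<Rightarrow> ('x \<Rightarrow> 'x \<Rightarrow> 'a) \<Rightarrow> 'x \<Rightarrow> 'x \<Rightarrow> 'a" where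
  "flat M B = (\<lambda>u\<in>carrier M. \<lambda>v\<in>carrier M. B u v)"

definition strongly_nondegenerate ::
  "('a, 'c) ring_scheme \<Rightarrow> ('a, 'x, 'd) module_scheme \<Rightarrow> ('x \<Rightarrow> 'x \<Rightarrow> 'a) \<Rightarrow> bool"
  where "strongly_nondegenerate R M B \<longleftrightarrow> flat M B \<in> mod_iso R M (dual_module R M)"

definition orth_defect ::
  "('a, 'c) ring_scheme \<Rightarrow> ('x list \<Rightarrow> 'x) \<Rightarrow> ('x list \<Rightarrow> 'a \<Rightarrow> 'a) \<Rightarrow> ('x \<Rightarrow> 'x \<Rightarrow> 'a) \<Rightarrow>
    'x list \<Rightarrow> 'x \<Rightarrow> 'x \<Rightarrow> 'a"
  where "orth_defect A br \<rho> B xs u v =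
    \<rho> xs (B u v) \<ominus>\<^bsub>A\<^esub> B (br (xs @ [u])) v \<ominus>\<^bsub>A\<^esub> B u (br (xs @ [v]))"

end

theory Submission
  imports Defs
begin

text \<open>Replacing \<open>x\<^sub>1\<close> by \<open>a x\<^sub>1\<close> in \<open>D\<^sub>X B = 0\<close> and expanding the bracket by the Leibniz rule in its first
  slot leaves \<open>\<phi>(u) B(x, v) + \<phi>(v) B(x, u) = 0\<close>, where \<open>\<phi>(u) = \<rho>(u, x\<^sub>2, \<dots>, x\<^sub>n\<^sub>-\<^sub>1)(a)\<close>. As \<open>B\<close> is
  strongly nondegenerate, \<open>\<phi>(u) f(v) + \<phi>(v) f(u) = 0\<close> for every linear form \<open>f\<close>, so
  \<open>\<phi>(u) f(v) f(w) = 0\<close> since 2 is invertible. For a finite dual basis \<open>(e\<^sub>i, f\<^sub>i)\<close> repeated use of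
  \<open>\<phi>(u) = \<Sum>\<^sub>i f\<^sub>i(u) \<phi>(e\<^sub>i)\<close> writes \<open>\<phi>(u)\<close> as a sum of terms in each of which some \<open>f\<^sub>i\<close> occurs
  twice. Hence \<open>\<phi> = 0\<close>.\<close>

section \<open>Linear forms\<close>

lemma mod_hom_self_moduleD:
  assumes "f \<in> mod_hom R M (self_module R)"
  shows "x \<in> carrier M \<Longrightarrow> f x \<in> carrier R"
    and "x \<in> carrier M \<Longrightarrow> y \<in> carrier M \<Longrightarrow> f (x \<oplus>\<^bsub>M\<^esub> y) = f x \<oplus>\<^bsub>R\<^esub> f y"
    and "r \<in> carrier R \<Longrightarrow> x \<in> carrier M \<Longrightarrow> f (r \<odot>\<^bsub>M\<^esub> x) = r \<otimes>\<^bsub>R\<^esub> f x"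
  using assms by (auto simp: mod_hom_def self_module_def)

lemma (in module) linear_form_zero:
  assumes "f \<in> mod_hom R M (self_module R)"
  shows "f \<zero>\<^bsub>M\<^esub> = \<zero>"
  using mod_hom_self_moduleD(3)[OF assms, of \<zero> "\<zero>\<^bsub>M\<^esub>"] mod_hom_self_moduleD(1)[OF assms]
  by simp

text \<open>Applied to coordinate forms, this makes all but finitely many of them zero on a finitely
  generated module.\<close>

lemma (in module) linear_form_vanishes_on_span:
  assumes f: "f \<in> mod_hom R M (self_module R)"
    and X: "finite X" "X \<subseteq> carrier M" "c \<in> X \<rightarrow> carrier R" "\<And>x. x \<in> X \<Longrightarrow> f x = \<zero>"
  shows "f (\<Oplus>\<^bsub>M\<^esub>x\<in>X. c x \<odot>\<^bsub>M\<^esub> x) = \<zero>"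
  using X
proof (induction X rule: finite_induct)
  case empty
  then show ?case using linear_form_zero[OF f] by simp
next
  case (insert x F)
  have *: "(\<lambda>x. c x \<odot>\<^bsub>M\<^esub> x) \<in> F \<rightarrow> carrier M" "c x \<in> carrier R" "x \<in> carrier M" "f x = \<zero>"
    using insert.prems by (auto intro!: smult_closed)
  then have "f (\<Oplus>\<^bsub>M\<^esub>x\<in>insert x F. c x \<odot>\<^bsub>M\<^esub> x) = f (c x \<odot>\<^bsub>M\<^esub> x) \<oplus> f (\<Oplus>\<^bsub>M\<^esub>x\<in>F. c x \<odot>\<^bsub>M\<^esub> x)"
    using insert.hyps mod_hom_self_moduleD(2)[OF f] by (simp add: M.finsum_closed)
  also have "\<dots> = \<zero>"
    using insert.IH insert.prems * mod_hom_self_moduleD(3)[OF f] by simp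
  finally show ?case .
qed

text \<open>With basis vectors \<open>e_i\<close>, the value \<open>d g(c)\<close> is the finite sum
  of the terms \<open>d c_i g(e_i)\<close>, and \<open>ann\<close> kills each of them. The induction
  removes one coordinate at a time from a finite set containing the support.\<close>

lemma (in cring) annihilates_free_module_form:
  assumes g: "g \<in> mod_hom R (free_module R I) (self_module R)"
    and d: "d \<in> carrier R" and S: "finite S"
    and c: "c \<in> carrier (free_module R I)" "{i \<in> I. c i \<noteq> \<zero>} \<subseteq> S"
    and ann: "\<And>i z. i \<in> I \<Longrightarrow> z \<in> carrier (free_module R I) \<Longrightarrow> d \<otimes> c i \<otimes> g z = \<zero>"
  shows "d \<otimes> g c = \<zero>"
  using S c ann
proof (induction S arbitrary: c rule: finite_induct)
  case empty
  have ci: "c \<in> I \<rightarrow>\<^sub>E carrier R" "\<And>i. i \<in> I \<Longrightarrow> c i = \<zero>"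
    using empty.prems(1,2) by (auto simp: free_module_def)
  \<comment> \<open>Writing \<open>c\<close> as zero times itself lets homogeneity alone give
    \<open>g c = 0\<close>; outside \<open>I\<close> both functions are
    \<open>undefined\<close>.\<close>
  have "c i = (\<zero> \<odot>\<^bsub>free_module R I\<^esub> c) i" for i
    using ci PiE_arb[OF ci(1), of i] by (cases "i \<in> I") (simp_all add: free_module_def)
  then have "c = \<zero> \<odot>\<^bsub>free_module R I\<^esub> c" by blast
  then have "g c = \<zero> \<otimes> g c"
    using mod_hom_self_moduleD(3)[OF g _ empty.prems(1), of \<zero>] by simp
  then show ?case using mod_hom_self_moduleD(1)[OF g empty.prems(1)] d by simp
next
  case (insert k S)
  have cE: "c \<in> I \<rightarrow>\<^sub>E carrier R" and fin: "finite {i \<in> I. c i \<noteq> \<zero>}"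
    using insert.prems(1) by (auto simp: free_module_def)
  show ?case
  proof (cases "k \<in> I")
    case False
    then show ?thesis using insert.IH[OF insert.prems(1) _ insert.prems(3)] insert.prems(2) by auto
  next
    case True
    \<comment> \<open>\<open>\<delta>\<close> is the basis vector at \<open>k\<close> and
      \<open>c'\<close> is \<open>c\<close> with its coordinate at \<open>k\<close> erased, so
      \<open>c\<close> is \<open>c k\<close> times \<open>\<delta>\<close> plus
      \<open>c'\<close>.\<close>
    define \<delta> where "\<delta> = (\<lambda>i\<in>I. if i = k then \<one> else \<zero>)"
    define c' where "c' = c(k := \<zero>)"
    have "finite {i \<in> I. \<delta> i \<noteq> \<zero>}"
      by (rule finite_subset[of _ "{k}"]) (auto simp: \<delta>_def)
    then have \<delta>: "\<delta> \<in> carrier (free_module R I)"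
      by (auto simp: free_module_def \<delta>_def)
    have "finite {i \<in> I. c' i \<noteq> \<zero>}"
      by (rule finite_subset[OF _ fin]) (auto simp: c'_def)
    then have c': "c' \<in> carrier (free_module R I)"
      using cE True by (auto simp: free_module_def c'_def PiE_iff extensional_def)
    have ck: "c k \<in> carrier R" using cE True by auto
    have sm: "c k \<odot>\<^bsub>free_module R I\<^esub> \<delta> \<in> carrier (free_module R I)"
    proof -
      have "finite {i \<in> I. (c k \<odot>\<^bsub>free_module R I\<^esub> \<delta>) i \<noteq> \<zero>}"
        by (rule finite_subset[of _ "{k}"]) (auto simp: \<delta>_def free_module_def ck)
      then show ?thesis using ck by (auto simp: free_module_def \<delta>_def)
    qed
    have "c i = (c k \<odot>\<^bsub>free_module R I\<^esub> \<delta> \<oplus>\<^bsub>free_module R I\<^esub> c') i" for i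
      using PiE_arb[OF cE, of i] PiE_mem[OF cE, of i] ck
      by (cases "i \<in> I") (simp_all add: free_module_def \<delta>_def c'_def)
    then have "c = c k \<odot>\<^bsub>free_module R I\<^esub> \<delta> \<oplus>\<^bsub>free_module R I\<^esub> c'" by blast
    then have gc: "g c = c k \<otimes> g \<delta> \<oplus> g c'"
      using mod_hom_self_moduleD(2)[OF g sm c'] mod_hom_self_moduleD(3)[OF g ck \<delta>] by simp
    have "d \<otimes> g c' = \<zero>"
    proof (rule insert.IH[OF c'])
      show "{i \<in> I. c' i \<noteq> \<zero>} \<subseteq> S" using insert.prems(2) by (auto simp: c'_def)
      show "d \<otimes> c' i \<otimes> g z = \<zero>" if "i \<in> I" "z \<in> carrier (free_module R I)" for i z
        using insert.prems(3)[OF that] mod_hom_self_moduleD(1)[OF g that(2)] d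
        by (simp add: c'_def)
    qed
    moreover have "d \<otimes> (c k \<otimes> g \<delta>) = \<zero>"
      using insert.prems(3)[OF True \<delta>] mod_hom_self_moduleD(1)[OF g \<delta>] d ck
      by (simp add: m_assoc)
    ultimately show ?thesis
      using gc mod_hom_self_moduleD(1)[OF g] \<delta> c' ck d by (simp add: r_distr)
  qed
qed

text \<open>The possible multipliers \<open>c\<close> carry the induction: the step for \<open>k\<close> passes from \<open>c\<close> to \<open>c f\<^sub>k(v)\<close>.\<close>

lemma (in module) annihilator_induct:
  assumes f: "\<And>i. i \<in> I \<Longrightarrow> f i \<in> carrier M \<rightarrow> carrier R"
    and \<phi>: "\<phi> \<in> carrier M \<rightarrow> carrier R"
    and sq: "\<And>i u v w. i \<in> I \<Longrightarrow> u \<in> carrier M \<Longrightarrow> v \<in> carrier M \<Longrightarrow> w \<in> carrier M \<Longrightarrow>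
      \<phi> u \<otimes> f i v \<otimes> f i w = \<zero>"
    and base: "\<And>c u. \<lbrakk>c \<in> carrier R; u \<in> carrier M;
      \<And>i v w. i \<in> I \<Longrightarrow> v \<in> carrier M \<Longrightarrow> w \<in> carrier M \<Longrightarrow> c \<otimes> f i v \<otimes> \<phi> w = \<zero>\<rbrakk> \<Longrightarrow> c \<otimes> \<phi> u = \<zero>"
    and S: "finite S" "S \<subseteq> I" and c: "c \<in> carrier R" and u: "u \<in> carrier M"
    and ann: "\<And>i v w. i \<in> I - S \<Longrightarrow> v \<in> carrier M \<Longrightarrow> w \<in> carrier M \<Longrightarrow> c \<otimes> f i v \<otimes> \<phi> w = \<zero>"
  shows "c \<otimes> \<phi> u = \<zero>"
  using S c u ann
proof (induction S arbitrary: c u rule: finite_induct)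
  case empty
  then show ?case using base by simp
next
  case (insert k S)
  \<comment> \<open>The multiplier \<open>c f_k(v)\<close> meets the induction hypothesis for
    \<open>S\<close>: outside \<open>S\<close>, the index \<open>k\<close> is settled by the square
    relation \<open>sq\<close> and every other index by the assumption on \<open>c\<close>.\<close>
  have step: "c \<otimes> f k v \<otimes> \<phi> w = \<zero>" if v: "v \<in> carrier M" and w: "w \<in> carrier M" for v w
  proof (rule insert.IH[OF _ _ w])
    show "S \<subseteq> I" "c \<otimes> f k v \<in> carrier R" using insert.prems(1,2) f[of k] v by auto
    fix i v' w' assume i: "i \<in> I - S" and v': "v' \<in> carrier M" and w': "w' \<in> carrier M"
    have cl: "f k v \<in> carrier R" "f i v' \<in> carrier R" "\<phi> w' \<in> carrier R"
      using f \<phi> insert.prems(1) i v v' w' by auto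
    show "c \<otimes> f k v \<otimes> f i v' \<otimes> \<phi> w' = \<zero>"
    proof (cases "i = k")
      case True
      have "c \<otimes> f k v \<otimes> f i v' \<otimes> \<phi> w' = c \<otimes> (\<phi> w' \<otimes> f k v \<otimes> f k v')"
        using cl insert.prems(2) True by (simp add: m_ac)
      then show ?thesis using sq[of k w' v v'] insert.prems(1,2) v v' w' by simp
    next
      case False
      have "c \<otimes> f k v \<otimes> f i v' \<otimes> \<phi> w' = f k v \<otimes> (c \<otimes> f i v' \<otimes> \<phi> w')"
        using cl insert.prems(2) by (simp add: m_ac)
      then show ?thesis using insert.prems(4)[of i v' w'] i False v' w' cl by simp
    qed
  qed
  show ?case
  \<comment> \<open>Second use of the induction hypothesis, now with \<open>c\<close> itself:
    \<open>step\<close> supplies the missing index \<open>k\<close>.\<close>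
  proof (rule insert.IH[OF _ insert.prems(2,3)])
    show "S \<subseteq> I" using insert.prems by auto
    show "c \<otimes> f i v \<otimes> \<phi> w = \<zero>" if "i \<in> I - S" "v \<in> carrier M" "w \<in> carrier M" for i v w
      using step insert.prems(4) that by (cases "i = k") auto
  qed
qed

section \<open>Linear forms that are skew against every linear form\<close>

text \<open>Three uses of \<open>skew\<close>, each changing the sign, carry the argument of \<phi>
  from \<open>u\<close> to \<open>v\<close> to \<open>w\<close> and back to \<open>u\<close>. The
  product therefore equals its own negative.\<close>

lemma (in cring) skew_product_square_zero:
  assumes two: "\<And>a. a \<in> carrier R \<Longrightarrow> a \<oplus> a = \<zero> \<Longrightarrow> a = \<zero>"
    and cl: "\<phi> \<in> V \<rightarrow> carrier R" "f \<in> V \<rightarrow> carrier R"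
    and skew: "\<And>u v. u \<in> V \<Longrightarrow> v \<in> V \<Longrightarrow> \<phi> u \<otimes> f v \<oplus> \<phi> v \<otimes> f u = \<zero>"
    and V: "u \<in> V" "v \<in> V" "w \<in> V"
  shows "\<phi> u \<otimes> f v \<otimes> f w = \<zero>"
proof (rule two)
  have c: "\<phi> x \<in> carrier R" "f x \<in> carrier R" if "x \<in> V" for x using cl that by auto
  have sw: "\<phi> x \<otimes> f y = \<ominus> (\<phi> y \<otimes> f x)" if "x \<in> V" "y \<in> V" for x y
    using skew[OF that] c that by (simp add: minus_equality)
  have "\<phi> u \<otimes> f v \<otimes> f w = \<ominus> (\<phi> v \<otimes> f w \<otimes> f u)"
    using sw[of u v] c V by (simp add: l_minus r_minus m_ac)
  also have "\<dots> = \<phi> w \<otimes> f u \<otimes> f v"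
    using sw[of v w] c V by (simp add: l_minus r_minus m_ac)
  also have "\<dots> = \<ominus> (\<phi> u \<otimes> f v \<otimes> f w)"
    using sw[of w u] c V by (simp add: l_minus r_minus m_ac)
  finally have "\<phi> u \<otimes> f v \<otimes> f w = \<ominus> (\<phi> u \<otimes> f v \<otimes> f w)" .
  then show "\<phi> u \<otimes> f v \<otimes> f w \<oplus> \<phi> u \<otimes> f v \<otimes> f w = \<zero>"
    using c V by (metis l_neg m_closed)
  show "\<phi> u \<otimes> f v \<otimes> f w \<in> carrier R" using c V by simp
qed

text \<open>Projectivity provides coordinate forms, and finite generation leaves only finitely many
  nonzero ones even when the free module has an infinite index set. On this finite set
  \<open>annihilator_induct\<close> runs.\<close>

lemma (in module) skew_linear_form_zero:
  assumes fg: "fin_gen_module R M" and proj: "projective_module R M"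
    and two: "\<And>a. a \<in> carrier R \<Longrightarrow> a \<oplus> a = \<zero> \<Longrightarrow> a = \<zero>"
    and \<phi>: "\<phi> \<in> mod_hom R M (self_module R)"
    and skew: "\<And>f u v. \<lbrakk>f \<in> mod_hom R M (self_module R); u \<in> carrier M; v \<in> carrier M\<rbrakk> \<Longrightarrow>
      \<phi> u \<otimes> f v \<oplus> \<phi> v \<otimes> f u = \<zero>"
    and u: "u \<in> carrier M"
  shows "\<phi> u = \<zero>"
proof -
  obtain I :: "'c set" and j p where j: "j \<in> mod_hom R M (free_module R I)"
    and p: "p \<in> mod_hom R (free_module R I) M" and pj: "\<And>x. x \<in> carrier M \<Longrightarrow> p (j x) = x"
    using proj unfolding projective_module_def by blast
  obtain X where X: "finite X" "X \<subseteq> carrier M"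
    and span: "\<And>y. y \<in> carrier M \<Longrightarrow> \<exists>c\<in>X \<rightarrow> carrier R. y = (\<Oplus>\<^bsub>M\<^esub>x\<in>X. c x \<odot>\<^bsub>M\<^esub> x)"
    using fg unfolding fin_gen_module_def by blast
  \<comment> \<open>The coordinates of the section \<open>j\<close> are the forms of the dual
    basis.\<close>
  define f where "f i = (\<lambda>x\<in>carrier M. j x i)" for i
  have jc: "j x \<in> carrier (free_module R I)" if "x \<in> carrier M" for x
    using j that by (auto simp: mod_hom_def)
  have pc: "p z \<in> carrier M" if "z \<in> carrier (free_module R I)" for z
    using p that by (auto simp: mod_hom_def)
  have f: "f i \<in> mod_hom R M (self_module R)" if "i \<in> I" for i
    using j jc that by (auto simp: mod_hom_def self_module_def f_def free_module_def)
  \<comment> \<open>\<open>J\<close> collects the supports of the images of the generators; a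
    coordinate outside \<open>J\<close> vanishes on the generators, hence everywhere.\<close>
  define J where "J = (\<Union>x\<in>X. {i \<in> I. j x i \<noteq> \<zero>})"
  have J: "finite J" "J \<subseteq> I"
    using X jc by (auto simp: J_def free_module_def)
  have supp: "j y i = \<zero>" if y: "y \<in> carrier M" and i: "i \<in> I - J" for y i
  proof -
    obtain c where c: "c \<in> X \<rightarrow> carrier R" "y = (\<Oplus>\<^bsub>M\<^esub>x\<in>X. c x \<odot>\<^bsub>M\<^esub> x)" using span[OF y] by blast
    have "f i x = \<zero>" if "x \<in> X" for x using that X i by (auto simp: f_def J_def)
    then have "f i y = \<zero>" using linear_form_vanishes_on_span[OF f X c(1)] c(2) i by simp
    then show ?thesis using y by (simp add: f_def)
  qed
  \<comment> \<open>Since \<open>p (j y) = y\<close>, the form \<phi> is \<open>g\<close> after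
    \<open>j\<close>, which moves the computation to a free module.\<close>
  define g where "g = (\<lambda>z\<in>carrier (free_module R I). \<phi> (p z))"
  \<comment> \<open>\<open>g\<close> is \<open>undefined\<close> off the carrier, so its linearity
    rests on the closure of the carrier under sums and multiples.\<close>
  have free_add: "z \<oplus>\<^bsub>free_module R I\<^esub> z' \<in> carrier (free_module R I)"
    if "z \<in> carrier (free_module R I)" "z' \<in> carrier (free_module R I)" for z z'
  proof -
    have "finite {i \<in> I. (z \<oplus>\<^bsub>free_module R I\<^esub> z') i \<noteq> \<zero>}"
      by (rule finite_subset[of _ "{i \<in> I. z i \<noteq> \<zero>} \<union> {i \<in> I. z' i \<noteq> \<zero>}"])
        (use that in \<open>auto simp: free_module_def\<close>)
    then show ?thesis using that by (auto simp: free_module_def)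
  qed
  have free_smult: "r \<odot>\<^bsub>free_module R I\<^esub> z \<in> carrier (free_module R I)"
    if "r \<in> carrier R" "z \<in> carrier (free_module R I)" for r z
  proof -
    have "finite {i \<in> I. (r \<odot>\<^bsub>free_module R I\<^esub> z) i \<noteq> \<zero>}"
      by (rule finite_subset[of _ "{i \<in> I. z i \<noteq> \<zero>}"]) (use that in \<open>auto simp: free_module_def\<close>)
    then show ?thesis using that by (auto simp: free_module_def)
  qed
  have g: "g \<in> mod_hom R (free_module R I) (self_module R)"
  proof -
    have "p (z \<oplus>\<^bsub>free_module R I\<^esub> z') = p z \<oplus>\<^bsub>M\<^esub> p z'"
      if "z \<in> carrier (free_module R I)" "z' \<in> carrier (free_module R I)" for z z'
      using p that by (auto simp: mod_hom_def)
    moreover have "p (r \<odot>\<^bsub>free_module R I\<^esub> z) = r \<odot>\<^bsub>M\<^esub> p z"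
      if "r \<in> carrier R" "z \<in> carrier (free_module R I)" for r z
      using p that by (auto simp: mod_hom_def)
    ultimately show ?thesis
      using mod_hom_self_moduleD[OF \<phi>] pc free_add free_smult
      by (auto simp: mod_hom_def[of R "free_module R I"] g_def self_module_def)
  qed
  \<comment> \<open>\<open>\<phi> y\<close> is a combination of values of \<phi> with coefficients
    \<open>f i y\<close>, and the assumption on \<open>c\<close> kills each such product.\<close>
  have base: "c \<otimes> \<phi> y = \<zero>"
    if c: "c \<in> carrier R" and y: "y \<in> carrier M"
      and ann: "\<And>i v w. \<lbrakk>i \<in> I; v \<in> carrier M; w \<in> carrier M\<rbrakk> \<Longrightarrow> c \<otimes> f i v \<otimes> \<phi> w = \<zero>" for c y
  proof -
    have "finite {i \<in> I. j y i \<noteq> \<zero>}" using jc[OF y] by (simp add: free_module_def)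
    then have "c \<otimes> g (j y) = \<zero>"
    proof (rule annihilates_free_module_form[OF g c _ jc[OF y] subset_refl])
      show "c \<otimes> j y i \<otimes> g z = \<zero>" if "i \<in> I" "z \<in> carrier (free_module R I)" for i z
        using ann[of i y "p z"] that y pc by (simp add: f_def g_def)
    qed
    then show ?thesis using y jc pj by (simp add: g_def)
  qed
  have \<phi>c: "\<phi> \<in> carrier M \<rightarrow> carrier R" and fc: "\<And>i. i \<in> I \<Longrightarrow> f i \<in> carrier M \<rightarrow> carrier R"
    using mod_hom_self_moduleD(1)[OF \<phi>] mod_hom_self_moduleD(1)[OF f] by auto
  \<comment> \<open>The multiplier is 1 and all of \<open>J\<close> is still to be treated; the
    hypothesis on the multiplier holds because the coordinates outside \<open>J\<close> are
    zero.\<close>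
  have "\<one> \<otimes> \<phi> u = \<zero>"
  proof (rule annihilator_induct[where S = J, OF fc \<phi>c _ base J _ u])
    show "\<phi> x \<otimes> f i v \<otimes> f i w = \<zero>"
      if "i \<in> I" "x \<in> carrier M" "v \<in> carrier M" "w \<in> carrier M" for i x v w
      using skew_product_square_zero[OF two \<phi>c fc[OF that(1)] skew[OF f[OF that(1)]] that(2-4)] .
    show "\<one> \<otimes> f i v \<otimes> \<phi> w = \<zero>" if "i \<in> I - J" "v \<in> carrier M" "w \<in> carrier M" for i v w
      using supp[of v i] that mod_hom_self_moduleD(1)[OF \<phi>, of w] by (simp add: f_def)
  qed auto
  then show ?thesis using mod_hom_self_moduleD(1)[OF \<phi> u] by simp
qed

section \<open>Brackets and anchors\<close>

lemma tuples_update: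
  "xs \<in> tuples M k \<Longrightarrow> a \<in> carrier M \<Longrightarrow> xs[i := a] \<in> tuples M k"
  using set_update_subset_insert[of xs i a] by (auto simp: tuples_def)

text \<open>Polarization: the value with \<open>x + y\<close> in both slots is zero, and so are the
  two diagonal terms of its expansion.\<close>

lemma alt_multilinear_swap:
  assumes f: "alt_multilinear R M k N f" and M: "abelian_group M" and N: "abelian_group N"
    and xs: "xs \<in> tuples M k" and ij: "i < k" "j < k" "i \<noteq> j"
    and x: "x \<in> carrier M" and y: "y \<in> carrier M"
  shows "f (xs[i := x, j := y]) \<oplus>\<^bsub>N\<^esub> f (xs[i := y, j := x]) = \<zero>\<^bsub>N\<^esub>"
proof -
  interpret M: abelian_group M by fact
  interpret N: abelian_group N by fact
  have tup: "xs[i := a, j := b] \<in> tuples M k" "xs[i := a] \<in> tuples M k" "xs[j := a] \<in> tuples M k"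
    if "a \<in> carrier M" "b \<in> carrier M" for a b
    using xs that by (simp_all add: tuples_update)
  have cl: "f (xs[i := a, j := b]) \<in> carrier N" if "a \<in> carrier M" "b \<in> carrier M" for a b
    using f tup[OF that] by (auto simp: alt_multilinear_def)
  have add: "f (zs[l := a \<oplus>\<^bsub>M\<^esub> b]) = f (zs[l := a]) \<oplus>\<^bsub>N\<^esub> f (zs[l := b])"
    if "zs \<in> tuples M k" "l < k" "a \<in> carrier M" "b \<in> carrier M" for zs l a b
    using f that unfolding alt_multilinear_def by blast
  have diag: "f (xs[i := a, j := a]) = \<zero>\<^bsub>N\<^esub>" if "a \<in> carrier M" for a
  proof -
    have "xs[i := a, j := a] ! i = xs[i := a, j := a] ! j"
      using ij xs by (simp add: tuples_def)
    then show ?thesis using f tup[OF that that] ij unfolding alt_multilinear_def by blast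
  qed
  let ?s = "x \<oplus>\<^bsub>M\<^esub> y"
  have s: "?s \<in> carrier M" using x y by simp
  have "\<zero>\<^bsub>N\<^esub> = f (xs[i := ?s, j := ?s])" using diag[OF s] by simp
  also have "\<dots> = f (xs[i := ?s, j := x]) \<oplus>\<^bsub>N\<^esub> f (xs[i := ?s, j := y])"
    using add[OF tup(2)] s x y ij by simp
  \<comment> \<open>\<open>add\<close> acts on the outermost update, so the update at
    \<open>i\<close> is first moved outside the one at \<open>j\<close>.\<close>
  also have "f (xs[i := ?s, j := x]) = f (xs[i := x, j := x]) \<oplus>\<^bsub>N\<^esub> f (xs[i := y, j := x])"
    using add[OF tup(3)[of x x], of i x y] x y ij
    by (simp add: list_update_swap[of j i xs])
  also have "f (xs[i := ?s, j := y]) = f (xs[i := x, j := y]) \<oplus>\<^bsub>N\<^esub> f (xs[i := y, j := y])"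
    using add[OF tup(3)[of y y], of i x y] x y ij
    by (simp add: list_update_swap[of j i xs])
  finally show ?thesis
    using diag[OF x] diag[OF y] cl[OF x y] cl[OF y x] by (simp add: N.a_comm)
qed

text \<open>2 is a unit of \<open>K\<close> and acts on \<open>A\<close> by scalars, so
  \<open>a\<close> is one half of \<open>a + a\<close>.\<close>

lemma char_zero_algebra_two_torsion_free:
  assumes "field K" "char_zero_ring K" "algebra K A" and a: "a \<in> carrier A" "a \<oplus>\<^bsub>A\<^esub> a = \<zero>\<^bsub>A\<^esub>"
  shows "a = \<zero>\<^bsub>A\<^esub>"
proof -
  interpret K: field K by fact
  interpret algebra K A by fact
  have "[(2::nat)] \<cdot>\<^bsub>K\<^esub> \<one>\<^bsub>K\<^esub> \<noteq> \<zero>\<^bsub>K\<^esub>" using assms(2) by (simp add: char_zero_ring_def)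
  then have t: "\<one>\<^bsub>K\<^esub> \<oplus>\<^bsub>K\<^esub> \<one>\<^bsub>K\<^esub> \<noteq> \<zero>\<^bsub>K\<^esub>" by (simp add: numeral_2_eq_2)
  let ?t = "\<one>\<^bsub>K\<^esub> \<oplus>\<^bsub>K\<^esub> \<one>\<^bsub>K\<^esub>"
  have u: "?t \<in> Units K" using t by (simp add: K.field_Units)
  have "a = (inv\<^bsub>K\<^esub> ?t \<otimes>\<^bsub>K\<^esub> ?t) \<odot>\<^bsub>A\<^esub> a" using u a by simp
  also have "\<dots> = inv\<^bsub>K\<^esub> ?t \<odot>\<^bsub>A\<^esub> (?t \<odot>\<^bsub>A\<^esub> a)"
    using u a by (intro smult_assoc1) (auto intro: K.Units_inv_closed)
  also have "?t \<odot>\<^bsub>A\<^esub> a = \<zero>\<^bsub>A\<^esub>" using a by (simp add: smult_l_distr)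
  also have "inv\<^bsub>K\<^esub> ?t \<odot>\<^bsub>A\<^esub> \<zero>\<^bsub>A\<^esub> = \<zero>\<^bsub>A\<^esub>" using u by (simp add: K.Units_inv_closed)
  finally show ?thesis .
qed

section \<open>The Leibniz rule in the first slot and the skew relation for the anchor\<close>

context n_Lie_Rinehart_algebra
begin

lemma anchor_closed:
  "xs \<in> tuples L (n - 1) \<Longrightarrow> a \<in> carrier A \<Longrightarrow> \<rho> xs a \<in> carrier A"
  using anchor by (auto simp: alt_multilinear_def Der_def mod_hom_def)

text \<open>The operations of \<open>Der K A\<close> are pointwise, so evaluation at
  \<open>a\<close> preserves linearity in the first slot. Taking \<open>x # xs\<close> as a tuple
  encodes that \<open>n - 1\<close> is positive and that \<open>xs\<close> is one entry
  shorter.\<close>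

lemma anchor_linear_form:
  assumes xs: "x # xs \<in> tuples L (n - 1)" and a: "a \<in> carrier A"
  shows "(\<lambda>u\<in>carrier L. \<rho> (u # xs) a) \<in> mod_hom A L (self_module A)"
proof -
  interpret module A L by (rule module)
  have n: "0 < n - 1" using xs by (auto simp: tuples_def)
  have "\<rho> (u # xs) a \<in> carrier A" if "u \<in> carrier L" for u
    using xs that a by (intro anchor_closed) (auto simp: tuples_def)
  moreover have "\<rho> ((u \<oplus>\<^bsub>L\<^esub> v) # xs) = \<rho> (u # xs) \<oplus>\<^bsub>Der K A\<^esub> \<rho> (v # xs)"
    if "u \<in> carrier L" "v \<in> carrier L" for u v
    using anchor xs n that unfolding alt_multilinear_def by (metis list_update_code(2))
  moreover have "\<rho> ((r \<odot>\<^bsub>L\<^esub> u) # xs) = r \<odot>\<^bsub>Der K A\<^esub> \<rho> (u # xs)"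
    if "r \<in> carrier A" "u \<in> carrier L" for r u
    using anchor xs n that unfolding alt_multilinear_def by (metis list_update_code(2))
  ultimately show ?thesis
    using a by (auto simp: mod_hom_def self_module_def Der_def)
qed

lemma bracket_closed:
  "xs \<in> tuples L n \<Longrightarrow> br xs \<in> carrier L"
  using n_Lie_algebra.bracket[OF n_Lie]
  by (auto simp: alt_multilinear_def tuples_def restrict_scalars_def)

text \<open>This carries the Leibniz rule from the last slot to the first. The bracket is
  multilinear over \<open>K\<close> only, but restriction of scalars keeps the addition and zero of
  \<open>L\<close>.\<close>

lemma bracket_swap_ends:
  assumes n: "n \<ge> 2" and xs: "xs \<in> tuples L (n - 2)" and x: "x \<in> carrier L" and y: "y \<in> carrier L"
  shows "br (x # xs @ [y]) \<oplus>\<^bsub>L\<^esub> br (y # xs @ [x]) = \<zero>\<^bsub>L\<^esub>"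
proof -
  let ?V = "restrict_scalars A L"
  interpret n_Lie_algebra K ?V n br by (rule n_Lie)
  interpret V: module K ?V by (rule module)
  have len: "length xs = n - 2" using xs by (simp add: tuples_def)
  \<comment> \<open>Both end entries are placeholders, overwritten by the updates at 0 and at
    \<open>n - 1\<close>, the last position when counting from 0.\<close>
  have zs: "x # xs @ [x] \<in> tuples ?V n"
    using xs x n by (auto simp: tuples_def restrict_scalars_def)
  have upd: "(x # xs @ [x])[0 := u, n - 1 := v] = u # xs @ [v]" for u v
  proof -
    have "n - 1 = Suc (length xs)" using len n by simp
    then show ?thesis by simp
  qed
  have "br ((x # xs @ [x])[0 := x, n - 1 := y]) \<oplus>\<^bsub>?V\<^esub> br ((x # xs @ [x])[0 := y, n - 1 := x]) = \<zero>\<^bsub>?V\<^esub>"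
    by (rule alt_multilinear_swap[OF bracket V.abelian_group_axioms V.abelian_group_axioms zs])
      (use n x y in \<open>auto simp: restrict_scalars_def\<close>)
  then show ?thesis unfolding upd by (simp add: restrict_scalars_def)
qed

text \<open>Swap the ends, apply \<open>Leibniz\<close>, swap back. The bracket term is swapped
  twice and keeps its sign; the anchor term is swapped once, whence the minus sign and the entry
  \<open>y\<close> in front.\<close>

lemma bracket_smult_first:
  assumes n: "n \<ge> 2" and xs: "xs \<in> tuples L (n - 2)" and x: "x \<in> carrier L" and y: "y \<in> carrier L"
    and a: "a \<in> carrier A"
  shows "br ((a \<odot>\<^bsub>L\<^esub> x) # xs @ [y]) = a \<odot>\<^bsub>L\<^esub> br (x # xs @ [y]) \<ominus>\<^bsub>L\<^esub> \<rho> (y # xs) a \<odot>\<^bsub>L\<^esub> x"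
proof -
  interpret module A L by (rule module)
  have tup: "u # xs @ [v] \<in> tuples L n" "u # xs \<in> tuples L (n - 1)"
    if "u \<in> carrier L" "v \<in> carrier L" for u v
    using xs n that by (auto simp: tuples_def)
  have cl: "br (u # xs @ [v]) \<in> carrier L" "\<rho> (u # xs) a \<in> carrier A"
    if "u \<in> carrier L" "v \<in> carrier L" for u v
    using bracket_closed anchor_closed tup that a by auto
  have ax: "a \<odot>\<^bsub>L\<^esub> x \<in> carrier L" using a x by simp
  have sw: "br (u # xs @ [v]) = \<ominus>\<^bsub>L\<^esub> br (v # xs @ [u])"
    if "u \<in> carrier L" "v \<in> carrier L" for u v
    using bracket_swap_ends[OF n xs that] cl that by (simp add: M.minus_equality)
  have "br ((a \<odot>\<^bsub>L\<^esub> x) # xs @ [y]) = \<ominus>\<^bsub>L\<^esub> br (y # xs @ [a \<odot>\<^bsub>L\<^esub> x])"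
    by (rule sw[OF ax y])
  also have "br (y # xs @ [a \<odot>\<^bsub>L\<^esub> x]) = a \<odot>\<^bsub>L\<^esub> br (y # xs @ [x]) \<oplus>\<^bsub>L\<^esub> \<rho> (y # xs) a \<odot>\<^bsub>L\<^esub> x"
    using Leibniz[OF tup(2)[OF y y] a x] by simp
  also have "br (y # xs @ [x]) = \<ominus>\<^bsub>L\<^esub> br (x # xs @ [y])" by (rule sw[OF y x])
  finally show ?thesis
    using cl[OF x y] cl[OF y y] a x by (simp add: smult_r_minus M.minus_add M.minus_eq)
qed

text \<open>Compare the orthogonality relation for first entry \<open>a x\<close> with
  \<open>a\<close> times the one for \<open>x\<close>. The anchor is \<open>A\<close>-linear, so the
  correction terms from \<open>bracket_smult_first\<close> must cancel.\<close>

lemma anchor_skew: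
  assumes n: "n \<ge> 2" and xs: "xs \<in> tuples L (n - 2)" and a: "a \<in> carrier A"
    and B: "sym_bilinear_form A L B"
    and orth: "\<And>xs u v. \<lbrakk>xs \<in> tuples L (n - 1); u \<in> carrier L; v \<in> carrier L\<rbrakk> \<Longrightarrow>
      orth_defect A br \<rho> B xs u v = \<zero>\<^bsub>A\<^esub>"
    and x: "x \<in> carrier L" and u: "u \<in> carrier L" and v: "v \<in> carrier L"
  shows "\<rho> (u # xs) a \<otimes>\<^bsub>A\<^esub> B x v \<oplus>\<^bsub>A\<^esub> \<rho> (v # xs) a \<otimes>\<^bsub>A\<^esub> B x u = \<zero>\<^bsub>A\<^esub>"
proof -
  interpret module A L by (rule module)
  have B_closed: "B w z \<in> carrier A" and B_comm: "B w z = B z w"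
    if "w \<in> carrier L" "z \<in> carrier L" for w z
    using B that unfolding sym_bilinear_form_def by blast+
  have B_add: "B (w \<oplus>\<^bsub>L\<^esub> w') z = B w z \<oplus>\<^bsub>A\<^esub> B w' z"
    if "w \<in> carrier L" "w' \<in> carrier L" "z \<in> carrier L" for w w' z
    using B that unfolding sym_bilinear_form_def by blast
  have B_smult: "B (r \<odot>\<^bsub>L\<^esub> w) z = r \<otimes>\<^bsub>A\<^esub> B w z"
    if "r \<in> carrier A" "w \<in> carrier L" "z \<in> carrier L" for r w z
    using B that unfolding sym_bilinear_form_def by blast
  have tup: "w # xs @ [z] \<in> tuples L n" "w # xs \<in> tuples L (n - 1)"
    if "w \<in> carrier L" "z \<in> carrier L" for w z
    using xs n that by (auto simp: tuples_def)
  have br_closed: "br (w # xs @ [z]) \<in> carrier L" if "w \<in> carrier L" "z \<in> carrier L" for w z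
    using bracket_closed tup that by auto
  have \<rho>_closed: "\<rho> (w # xs) b \<in> carrier A" if "w \<in> carrier L" "b \<in> carrier A" for w b
    using anchor_closed tup that by auto
  have ax: "a \<odot>\<^bsub>L\<^esub> x \<in> carrier L" using a x by simp
  \<comment> \<open>Symmetry places both brackets in the first argument of \<open>B\<close>, so
    \<open>expand_bracket\<close> covers both terms.\<close>
  have expand: "\<rho> (w # xs) (B u v) = B (br (w # xs @ [u])) v \<oplus>\<^bsub>A\<^esub> B (br (w # xs @ [v])) u"
    if w: "w \<in> carrier L" for w
  proof -
    have "\<rho> (w # xs) (B u v) \<ominus>\<^bsub>A\<^esub> B (br (w # xs @ [u])) v \<ominus>\<^bsub>A\<^esub> B (br (w # xs @ [v])) u = \<zero>\<^bsub>A\<^esub>"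
      using orth[OF tup(2)[OF w w] u v] B_comm[OF u br_closed[OF w v]] by (simp add: orth_defect_def)
    moreover have "\<rho> (w # xs) (B u v) \<in> carrier A" "B (br (w # xs @ [u])) v \<in> carrier A"
      "B (br (w # xs @ [v])) u \<in> carrier A"
      using w u v by (simp_all add: \<rho>_closed B_closed br_closed)
    ultimately show ?thesis
      by (smt (verit) R.a_assoc R.add.inv_closed R.add.m_closed R.l_zero R.minus_eq R.r_neg1
          R.r_neg2 R.a_comm R.r_zero)
  qed
  have expand_bracket: "B (br ((a \<odot>\<^bsub>L\<^esub> x) # xs @ [w])) z =
      a \<otimes>\<^bsub>A\<^esub> B (br (x # xs @ [w])) z \<oplus>\<^bsub>A\<^esub> \<ominus>\<^bsub>A\<^esub> (\<rho> (w # xs) a \<otimes>\<^bsub>A\<^esub> B x z)"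
    if w: "w \<in> carrier L" and z: "z \<in> carrier L" for w z
  proof -
    have "br ((a \<odot>\<^bsub>L\<^esub> x) # xs @ [w]) =
        a \<odot>\<^bsub>L\<^esub> br (x # xs @ [w]) \<oplus>\<^bsub>L\<^esub> (\<ominus>\<^bsub>A\<^esub> \<rho> (w # xs) a) \<odot>\<^bsub>L\<^esub> x"
      using bracket_smult_first[OF n xs x w a] \<rho>_closed[OF w a] x by (simp add: smult_l_minus M.minus_eq)
    then show ?thesis
      using w z x a by (simp add: B_add B_smult B_closed br_closed \<rho>_closed R.l_minus)
  qed
  let ?P = "B (br (x # xs @ [u])) v" and ?Q = "B (br (x # xs @ [v])) u"
    and ?S = "\<rho> (u # xs) a \<otimes>\<^bsub>A\<^esub> B x v" and ?T = "\<rho> (v # xs) a \<otimes>\<^bsub>A\<^esub> B x u"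
  have cl: "?P \<in> carrier A" "?Q \<in> carrier A" "?S \<in> carrier A" "?T \<in> carrier A"
    using x u v a by (simp_all add: \<rho>_closed B_closed br_closed)
  have Buv: "B u v \<in> carrier A" using B_closed[OF u v] .
  \<comment> \<open>The linear form of \<open>anchor_linear_form\<close> is taken here at
    \<open>B u v\<close> instead of \<open>a\<close>.\<close>
  have "\<rho> ((a \<odot>\<^bsub>L\<^esub> x) # xs) (B u v) = a \<otimes>\<^bsub>A\<^esub> \<rho> (x # xs) (B u v)"
    using mod_hom_self_moduleD(3)[OF anchor_linear_form[OF tup(2)[OF x x] Buv] a x] ax x by simp
  \<comment> \<open>The left side is the relation at \<open>a x\<close>, the right side
    \<open>a\<close> times the relation at \<open>x\<close>.\<close>
  then have "(a \<otimes>\<^bsub>A\<^esub> ?P \<oplus>\<^bsub>A\<^esub> \<ominus>\<^bsub>A\<^esub> ?S) \<oplus>\<^bsub>A\<^esub> (a \<otimes>\<^bsub>A\<^esub> ?Q \<oplus>\<^bsub>A\<^esub> \<ominus>\<^bsub>A\<^esub> ?T) = a \<otimes>\<^bsub>A\<^esub> (?P \<oplus>\<^bsub>A\<^esub> ?Q)"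
    using expand[OF x] expand[OF ax] expand_bracket[OF u v] expand_bracket[OF v u] by simp
  then have "a \<otimes>\<^bsub>A\<^esub> (?P \<oplus>\<^bsub>A\<^esub> ?Q) \<oplus>\<^bsub>A\<^esub> \<ominus>\<^bsub>A\<^esub> (?S \<oplus>\<^bsub>A\<^esub> ?T) = a \<otimes>\<^bsub>A\<^esub> (?P \<oplus>\<^bsub>A\<^esub> ?Q)"
    using cl a by (simp add: R.r_distr R.minus_add R.a_ac)
  then have "\<ominus>\<^bsub>A\<^esub> (?S \<oplus>\<^bsub>A\<^esub> ?T) = \<zero>\<^bsub>A\<^esub>"
    using cl a by (simp add: R.add.l_cancel_one)
  then show ?thesis using cl by (metis R.add.inv_eq_1_iff R.a_closed)
qed

end

section \<open>Representing linear forms by \<open>B\<close>, and vanishing of the anchor\<close>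

text \<open>Surjectivity of \<open>flat M B\<close> onto the dual module.\<close>

lemma strongly_nondegenerate_represents:
  assumes "strongly_nondegenerate R M B" "f \<in> mod_hom R M (self_module R)"
  obtains x where "x \<in> carrier M" "\<And>v. v \<in> carrier M \<Longrightarrow> f v = B x v"
proof -
  have "f \<in> flat M B ` carrier M"
    using assms by (auto simp: strongly_nondegenerate_def mod_iso_def bij_betw_def dual_module_def)
  then show thesis using that by (auto simp: flat_def)
qed

theorem theorem4p13:
  fixes K :: "('k, 'c) ring_scheme" and A :: "('k, 'a, 'd) module_scheme"
    and L :: "('a, 'x, 'e) module_scheme"
    and n :: nat and br :: "'x list \<Rightarrow> 'x" and \<rho> :: "'x list \<Rightarrow> 'a \<Rightarrow> 'a"
    and B :: "'x \<Rightarrow> 'x \<Rightarrow> 'a"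
  assumes "field K" and "char_zero_ring K" and "algebra K A" and "n \<ge> 2"
    and "n_Lie_Rinehart_algebra K A L n br \<rho>"
    and "fin_gen_module A L" and "projective_module A L"
    and "\<And>P. primeideal P A \<Longrightarrow> \<exists>r\<ge>2. has_rank_at A L P r"
    and "sym_bilinear_form A L B" and "strongly_nondegenerate A L B"
    and "\<And>xs u v. \<lbrakk>xs \<in> tuples L (n - 1); u \<in> carrier L; v \<in> carrier L\<rbrakk> \<Longrightarrow>
      orth_defect A br \<rho> B xs u v = \<zero>\<^bsub>A\<^esub>"
  shows "\<forall>xs\<in>tuples L (n - 1). \<rho> xs = \<zero>\<^bsub>Der K A\<^esub>"
proof
  interpret n_Lie_Rinehart_algebra K A L n br \<rho> by fact
  interpret L: module A L by (rule module)
  fix us assume us: "us \<in> tuples L (n - 1)"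
  \<comment> \<open>As \<open>n - 1\<close> is at least 1, a first entry can be split off; it
    becomes the variable of \<phi>.\<close>
  then obtain u xs where us_eq: "us = u # xs"
    using \<open>n \<ge> 2\<close> by (cases us) (auto simp: tuples_def)
  have u: "u \<in> carrier L" and xs: "xs \<in> tuples L (n - 2)"
    using us us_eq by (auto simp: tuples_def)
  have zero: "\<rho> us a = \<zero>\<^bsub>A\<^esub>" if a: "a \<in> carrier A" for a
  proof -
    have "(\<lambda>u\<in>carrier L. \<rho> (u # xs) a) u = \<zero>\<^bsub>A\<^esub>"
    proof (rule L.skew_linear_form_zero[OF assms(6,7) _ _ _ u])
      show "c = \<zero>\<^bsub>A\<^esub>" if "c \<in> carrier A" "c \<oplus>\<^bsub>A\<^esub> c = \<zero>\<^bsub>A\<^esub>" for c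
        using char_zero_algebra_two_torsion_free[OF assms(1-3) that] .
      show "(\<lambda>u\<in>carrier L. \<rho> (u # xs) a) \<in> mod_hom A L (self_module A)"
        using anchor_linear_form us us_eq a by blast
      \<comment> \<open>Once \<open>f\<close> is written as \<open>B x\<close>, the required
        relation is \<open>anchor_skew\<close>.\<close>
      fix f v w assume f: "f \<in> mod_hom A L (self_module A)" and vw: "v \<in> carrier L" "w \<in> carrier L"
      obtain x where x: "x \<in> carrier L" "\<And>v. v \<in> carrier L \<Longrightarrow> f v = B x v"
        using strongly_nondegenerate_represents[OF assms(10) f] by blast
      show "(\<lambda>u\<in>carrier L. \<rho> (u # xs) a) v \<otimes>\<^bsub>A\<^esub> f w \<oplus>\<^bsub>A\<^esub>
          (\<lambda>u\<in>carrier L. \<rho> (u # xs) a) w \<otimes>\<^bsub>A\<^esub> f v = \<zero>\<^bsub>A\<^esub>"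
        using anchor_skew[OF assms(4) xs a assms(9,11) x(1) vw] vw x(2) by simp
    qed
    then show ?thesis using u us_eq by simp
  qed
  \<comment> \<open>The zero derivation is a restricted function, so equality also requires
    \<open>\<rho> us\<close> to be \<open>undefined\<close> off the carrier of
    \<open>A\<close>.\<close>
  have "\<rho> us \<in> extensional (carrier A)"
    using anchor us by (auto simp: alt_multilinear_def Der_def mod_hom_def PiE_def)
  then show "\<rho> us = \<zero>\<^bsub>Der K A\<^esub>"
    using zero by (auto simp: Der_def extensional_def fun_eq_iff)
qed

end
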